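(* Let $b\ge1$ be an integer, and let $\Delta_{n,k}$ denote the number of vertices of the Horadam cube $\Pi^{1,b}_n$ with exactly $k$ neighbors. Then for all $n\ge3$ and all $k\ge 0$, $$\Delta_{n,k}=\Delta_{n-1,k-1}+\Delta_{n-2,k-1}+(b-1)\Delta_{n-2,k-2}+\Delta_{n-3,k-1}+(b-2)\Delta_{n-3,k-2}-(b-1)\Delta_{n-3,k-3},$$ with initial values $\Delta_{0,0}=1$, $\Delta_{1,0}=1$, $\Delta_{2,1}=2$ and $\Delta_{2,2}=b-1$ (all other $\Delta_{0,k}$, $\Delta_{1,k}$, $\Delta_{2,k}$ being $0$).
   Context: For an integer $b\ge1$ and $n\ge 0$, $\mathcal S^{1,b}_n$ is the set of all strings of length $n$ over the alphabet $\{0,1,\dots,b\}$ in which every letter from $\{1,\dots,b\}$ appears only immediately after a letter $0$; $\mathcal S^{1,b}_0$ contains only the empty string. The Horadam cube $\Pi^{1,b}_n$ is the simple graph with vertex set $\mathcal S^{1,b}_n$ in which $x_1\cdots x_n$ and $y_1\cdots y_n$ are adjacent if and only if $\sum_{i=1}^n|x_i-y_i|=1$. By convention $\Delta_{n,k}=0$ for $k<0$. *)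

theory Defs
  imports "Graph_Theory.Pair_Digraph"
begin

definition horadam_strings :: "nat \<Rightarrow> nat \<Rightarrow> nat list set" where
  "horadam_strings b n = {x. length x = n \<and> set x \<subseteq> {0..b} \<and>
     (\<forall>i<n. x ! i \<in> {1..b} \<longrightarrow> i > 0 \<and> x ! (i - 1) = 0)}"

text \<open>A simple graph is a finite, loop-free, symmetric digraph without parallel arcs
  (locale \<open>pair_graph\<close>): each edge is represented by its two orientations.\<close>

definition horadam_cube :: "nat \<Rightarrow> nat \<Rightarrow> nat list pair_pre_digraph" where
  "horadam_cube b n = \<lparr> pverts = horadam_strings b n,
     parcs = {(x, y). x \<in> horadam_strings b n \<and> y \<in> horadam_strings b n \<and>
                (\<Sum>i<n. \<bar>int (x ! i) - int (y ! i)\<bar>) = 1} \<rparr>"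

lemma finite_horadam_strings: "finite (horadam_strings b n)"
  by (rule finite_subset[OF _ finite_lists_length_eq[of "{0..b}" n]])
     (auto simp: horadam_strings_def)

lemma pair_graph_horadam_cube: "pair_graph (horadam_cube b n)"
proof unfold_locales
  show "finite (parcs (horadam_cube b n))"
    by (rule finite_subset[of _ "horadam_strings b n \<times> horadam_strings b n"])
       (auto simp: horadam_cube_def finite_horadam_strings)
  show "Digraph.symmetric (with_proj (horadam_cube b n))"
    by (auto simp: symmetric_def horadam_cube_def abs_minus_commute intro!: symI)
qed (auto simp: horadam_cube_def finite_horadam_strings)

definition neighbors :: "'a pair_pre_digraph \<Rightarrow> 'a \<Rightarrow> 'a set" where
  "neighbors G x = {y \<in> pverts G. (x, y) \<in> parcs G}"

text \<open>The index \<open>k\<close> is an integer because the recurrence refers to \<open>k - 1\<close>, \<open>k - 2\<close>, \<open>k - 3\<close>;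
  the value for negative \<open>k\<close> is 0.\<close>

definition \<Delta> :: "nat \<Rightarrow> nat \<Rightarrow> int \<Rightarrow> nat" where
  "\<Delta> b n k = card {x \<in> pverts (horadam_cube b n). int (card (neighbors (horadam_cube b n) x)) = k}"

lemma \<Delta>_neg: "k < 0 \<Longrightarrow> \<Delta> b n k = 0"
  by (auto simp: \<Delta>_def)

end

theory Submission
  imports Defs
begin

text \<open>A Horadam string is a concatenation of blocks \<open>0\<close> and \<open>0j\<close> with \<open>1 \<le> j \<le> b\<close>. The letter \<open>j\<close>
  contributes 1 to the degree if \<open>j = b\<close> and 2 otherwise, and a block \<open>0\<close> contributes 1 exactly if
  the preceding block is also \<open>0\<close>. Hence, with \<open>w = t + (b - 1) t\<^sup>2\<close>, the degree enumerators \<open>f n\<close>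
  of all strings and \<open>g n\<close> of the strings continuing a block \<open>0\<close> satisfy
  \<open>f n = g (n - 1) + w f (n - 2)\<close> and \<open>g n = t g (n - 1) + w f (n - 2)\<close>; eliminating \<open>g\<close> gives
  \<open>f n = t f (n - 1) + w f (n - 2) + w (1 - t) f (n - 3)\<close>.\<close>

text \<open>The flag \<open>z\<close> records whether the letter preceding the string is \<open>0\<close>.\<close>

fun valid :: "nat \<Rightarrow> bool \<Rightarrow> nat list \<Rightarrow> bool" where
  "valid b z [] = True"
| "valid b z (a # x) = ((a = 0 \<or> z) \<and> a \<le> b \<and> valid b (a = 0) x)"

text \<open>A letter 0 can be raised to 1 only if a 0 precedes it (\<open>z\<close>) and no nonzero
  letter follows it (\<open>valid b False x\<close>).\<close>

fun degree :: "nat \<Rightarrow> bool \<Rightarrow> nat list \<Rightarrow> nat" where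
  "degree b z [] = 0"
| "degree b z (a # x) = degree b (a = 0) x +
     (if a = 0 then (if z \<and> valid b False x then 1 else 0) else if a < b then 2 else 1)"

section \<open>Degrees in the cube, computed letter by letter\<close>

definition l1_dist :: "nat list \<Rightarrow> nat list \<Rightarrow> int" where
  "l1_dist x y = (\<Sum>i<length x. \<bar>int (x ! i) - int (y ! i)\<bar>)"

lemma l1_dist_Nil [simp]: "l1_dist [] y = 0"
  by (simp add: l1_dist_def)

lemma l1_dist_Cons [simp]: "l1_dist (a # x) (c # y) = \<bar>int a - int c\<bar> + l1_dist x y"
  by (simp add: l1_dist_def sum.lessThan_Suc_shift del: sum.lessThan_Suc)

lemma l1_dist_nonneg: "l1_dist x y \<ge> 0"
  by (simp add: l1_dist_def sum_nonneg)

lemma l1_dist_eq_0_iff: "length x = length y \<Longrightarrow> l1_dist x y = 0 \<longleftrightarrow> x = y"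
  by (auto simp: l1_dist_def sum_nonneg_eq_0_iff list_eq_iff_nth_eq)

lemma valid_mono: "valid b False x \<Longrightarrow> valid b z x"
  by (cases x) auto

lemma valid_iff:
  "valid b z x \<longleftrightarrow> set x \<subseteq> {0..b} \<and>
     (\<forall>i<length x. x ! i \<noteq> 0 \<longrightarrow> (if i = 0 then z else x ! (i - 1) = 0))"
proof (induction x arbitrary: z)
  case (Cons a x)
  have "(\<forall>i<length x. x ! i \<noteq> 0 \<longrightarrow> (if i = 0 then a = 0 else x ! (i - 1) = 0)) \<longleftrightarrow>
      (\<forall>i<length x. x ! i \<noteq> 0 \<longrightarrow> (a # x) ! i = 0)"
    by (auto simp: nth_Cons')
  then show ?case
    by (auto simp: Cons.IH All_less_Suc2)
qed simp

lemma horadam_strings_eq: "horadam_strings b n = {x. valid b False x \<and> length x = n}"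
proof -
  have letter: "(x ! i \<in> {1..b} \<longrightarrow> i > 0 \<and> x ! (i - 1) = 0) \<longleftrightarrow>
      (x ! i \<noteq> 0 \<longrightarrow> (if i = 0 then False else x ! (i - 1) = 0))"
    if "set x \<subseteq> {0..b}" "i < length x" for x i
  proof -
    have "x ! i \<in> {1..b} \<longleftrightarrow> x ! i \<noteq> 0"
      using that nth_mem[of i x] by (auto simp del: nth_mem)
    then show ?thesis by simp
  qed
  have "x \<in> horadam_strings b n \<longleftrightarrow> valid b False x \<and> length x = n" for x
    unfolding horadam_strings_def valid_iff mem_Collect_eq using letter[of x] by blast
  then show ?thesis
    by blast
qed

text \<open>The flag extends neighborhoods to tails of strings, for induction on the string; on
  Horadam strings, \<open>z = False\<close> gives the neighborhoods in the cube.\<close>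

definition nbrs :: "nat \<Rightarrow> bool \<Rightarrow> nat list \<Rightarrow> nat list set" where
  "nbrs b z x = {y. valid b z y \<and> length y = length x \<and> l1_dist x y = 1}"

lemma finite_valid: "finite {x. valid b z x \<and> length x = n}"
  by (rule finite_subset[OF _ finite_lists_length_eq[of "{0..b}" n]]) (auto simp: valid_iff)

lemma finite_nbrs: "finite (nbrs b z x)"
  by (rule finite_subset[OF _ finite_valid[of b z "length x"]]) (auto simp: nbrs_def)

text \<open>Nonnegative integers with sum 1 have a single nonzero term: either the tail moves one
  step or the first letter does, never both.\<close>

lemma nbrs_Cons:
  assumes "valid b z (a # x)"
  shows "nbrs b z (a # x) =
    (#) a ` nbrs b (a = 0) x \<union> (\<lambda>c. c # x) ` {c. \<bar>int a - int c\<bar> = 1 \<and> valid b z (c # x)}"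
    (is "?L = ?R")
proof (rule set_eqI)
  fix y
  show "y \<in> ?L \<longleftrightarrow> y \<in> ?R"
  proof (cases y)
    case Nil
    then show ?thesis by (auto simp: nbrs_def)
  next
    case (Cons c v)
    have split: "\<bar>int a - int c\<bar> + l1_dist x v = 1 \<longleftrightarrow>
        (c = a \<and> l1_dist x v = 1) \<or> (\<bar>int a - int c\<bar> = 1 \<and> v = x)" if "length v = length x"
      using l1_dist_nonneg[of x v] l1_dist_eq_0_iff[of x v] that by auto
    show ?thesis
      using Cons assms split l1_dist_eq_0_iff[of x x] by (auto simp: nbrs_def image_iff)
  qed
qed

text \<open>The tail after a nonzero letter is valid for the flag \<open>False\<close>, so by
  \<open>valid_mono\<close> it stays admissible when that letter changes. Only raising 0 to 1
  constrains the tail.\<close>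

lemma letter_nbrs:
  assumes "valid b z (a # x)"
  shows "{c. \<bar>int a - int c\<bar> = 1 \<and> valid b z (c # x)} =
    (if a = 0 then if z \<and> b \<ge> 1 \<and> valid b False x then {1} else {}
     else if a < b then {a - 1, a + 1} else {a - 1})"
  using assms by (auto intro: valid_mono)

lemma card_nbrs:
  assumes "b \<ge> 1" "valid b z x"
  shows "card (nbrs b z x) = degree b z x"
  using assms(2)
proof (induction x arbitrary: z)
  case Nil
  then show ?case by (simp add: nbrs_def)
next
  case (Cons a x)
  let ?C = "{c. \<bar>int a - int c\<bar> = 1 \<and> valid b z (c # x)}"
  have fin: "finite ?C"
    unfolding letter_nbrs[OF Cons.prems] by simp
  \<comment> \<open>The union is disjoint: the first part keeps the first letter, the second changes
    it.\<close>
  have "card (nbrs b z (a # x)) = card ((#) a ` nbrs b (a = 0) x) + card ((\<lambda>c. c # x) ` ?C)"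
    unfolding nbrs_Cons[OF Cons.prems] using fin finite_nbrs[of b "a = 0" x]
    by (intro card_Un_disjoint) auto
  also have "\<dots> = degree b (a = 0) x + card ?C"
    using Cons by (simp add: card_image inj_on_def)
  also have "\<dots> = degree b z (a # x)"
    \<comment> \<open>\<open>b \<ge> 1\<close> makes the letter 1 available, as the clause of
      \<open>degree\<close> for 0 presumes.\<close>
    using assms(1) unfolding letter_nbrs[OF Cons.prems] by (auto simp: card_insert_if)
  finally show ?case .
qed

section \<open>Counts of strings by length and degree\<close>

definition strings :: "nat \<Rightarrow> nat \<Rightarrow> int \<Rightarrow> nat list set" where
  "strings b n k = {x. valid b False x \<and> length x = n \<and> int (degree b False x) = k}"

text \<open>Continuations of a letter \<open>0\<close>, split by whether their first letter is nonzero.\<close>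

definition zero_tails :: "nat \<Rightarrow> nat \<Rightarrow> int \<Rightarrow> nat list set" where
  "zero_tails b n k = {x. valid b False x \<and> length x = n \<and> int (degree b True x) = k}"

definition nonzero_tails :: "nat \<Rightarrow> nat \<Rightarrow> int \<Rightarrow> nat list set" where
  "nonzero_tails b n k =
     {x. valid b True x \<and> \<not> valid b False x \<and> length x = n \<and> int (degree b True x) = k}"

lemma finite_tails [simp]:
  "finite (strings b n k)" "finite (zero_tails b n k)" "finite (nonzero_tails b n k)"
  by (rule finite_subset[OF _ finite_valid[of b True n]],
      auto simp: strings_def zero_tails_def nonzero_tails_def intro: valid_mono)+

lemma Delta_eq_card_strings:
  assumes "b \<ge> 1"
  shows "\<Delta> b n k = card (strings b n k)"
proof -
  have "neighbors (horadam_cube b n) x = nbrs b False x" if "x \<in> horadam_strings b n" for x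
    using that by (auto simp: neighbors_def horadam_cube_def horadam_strings_eq nbrs_def l1_dist_def)
  then have "{x \<in> pverts (horadam_cube b n). int (card (neighbors (horadam_cube b n) x)) = k}
      = strings b n k"
    using card_nbrs[OF assms]
    by (auto simp: horadam_cube_def horadam_strings_eq strings_def)
  then show ?thesis
    by (simp add: \<Delta>_def)
qed

lemma card_strings_0: "card (strings b 0 k) = (if k = 0 then 1 else 0)"
proof -
  have "strings b 0 k = (if k = 0 then {[]} else {})"
    by (auto simp: strings_def)
  then show ?thesis by simp
qed

lemma card_zero_tails_0: "card (zero_tails b 0 k) = (if k = 0 then 1 else 0)"
proof -
  have "zero_tails b 0 k = (if k = 0 then {[]} else {})"
    by (auto simp: zero_tails_def)
  then show ?thesis by simp
qed

lemma card_nonzero_tails_0: "card (nonzero_tails b 0 k) = 0"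
  by (auto simp: nonzero_tails_def)

text \<open>The leading 0 of a string has no 0 before it, so it adds nothing to the degree.\<close>

lemma card_strings_Suc:
  "card (strings b (Suc n) k) = card (zero_tails b n k) + card (nonzero_tails b n k)"
proof -
  have "strings b (Suc n) k = (#) 0 ` (zero_tails b n k \<union> nonzero_tails b n k)"
    by (auto simp: strings_def zero_tails_def nonzero_tails_def length_Suc_conv image_iff
        intro: valid_mono)
  moreover have "card (zero_tails b n k \<union> nonzero_tails b n k)
      = card (zero_tails b n k) + card (nonzero_tails b n k)"
    by (rule card_Un_disjoint, simp, simp) (auto simp: zero_tails_def nonzero_tails_def)
  ultimately show ?thesis
    by (simp add: card_image)
qed

text \<open>Here the leading 0 follows another 0, so it adds 1 to the degree unless a nonzero letter
  comes next; hence the shift to \<open>k - 1\<close> in one summand only.\<close>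

lemma card_zero_tails_Suc:
  "card (zero_tails b (Suc n) k) = card (nonzero_tails b n k) + card (zero_tails b n (k - 1))"
proof -
  have "zero_tails b (Suc n) k = (#) 0 ` (nonzero_tails b n k \<union> zero_tails b n (k - 1))"
    using valid_mono[of b _ True]
    by (fastforce simp: zero_tails_def nonzero_tails_def length_Suc_conv image_iff
        split: if_splits)
  moreover have "card (nonzero_tails b n k \<union> zero_tails b n (k - 1))
      = card (nonzero_tails b n k) + card (zero_tails b n (k - 1))"
    by (rule card_Un_disjoint, simp, simp) (auto simp: zero_tails_def nonzero_tails_def)
  ultimately show ?thesis
    by (simp add: card_image)
qed

text \<open>What follows a nonzero letter is again an ordinary string. The letter \<open>b\<close>
  can only be lowered, while each of the other \<open>b - 1\<close> can move both ways; this is the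
  factor \<open>w\<close>.\<close>

lemma card_nonzero_tails_Suc:
  assumes "b \<ge> 1"
  shows "card (nonzero_tails b (Suc n) k) =
    card (strings b n (k - 1)) + (b - 1) * card (strings b n (k - 2))"
proof -
  let ?top = "(#) b ` strings b n (k - 1)"
  let ?low = "(\<lambda>(j, x). j # x) ` ({1..<b} \<times> strings b n (k - 2))"
  have "nonzero_tails b (Suc n) k = ?top \<union> ?low"
    using assms
    by (auto simp: strings_def nonzero_tails_def length_Suc_conv image_iff split: if_splits)
  moreover have "card (?top \<union> ?low) = card ?top + card ?low"
    by (rule card_Un_disjoint) auto
  moreover have "card ?low = (b - 1) * card (strings b n (k - 2))"
    by (subst card_image) (auto simp: inj_on_def card_cartesian_product)
  ultimately show ?thesis
    by (simp add: card_image)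
qed

lemma card_strings_recurrence:
  assumes "b \<ge> 1"
  shows "int (card (strings b (n + 3) k)) =
    int (card (strings b (n + 2) (k - 1))) + int (card (strings b (n + 1) (k - 1)))
    + (int b - 1) * int (card (strings b (n + 1) (k - 2)))
    + int (card (strings b n (k - 1)))
    + (int b - 2) * int (card (strings b n (k - 2)))
    - (int b - 1) * int (card (strings b n (k - 3)))"
proof -
  have nonzero: "int (card (nonzero_tails b (Suc m) l)) =
      int (card (strings b m (l - 1))) + (int b - 1) * int (card (strings b m (l - 2)))" for m l
    using card_nonzero_tails_Suc[OF assms] assms by (simp add: of_nat_diff)
  have "int (card (strings b (n + 3) k)) =
      int (card (nonzero_tails b (Suc n) k)) + int (card (zero_tails b (Suc n) (k - 1)))
      + int (card (nonzero_tails b (Suc (Suc n)) k))"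
    by (simp add: numeral_3_eq_3 card_strings_Suc card_zero_tails_Suc[of b "Suc n"])
  \<comment> \<open>Solving \<open>card_strings_Suc\<close> for \<open>zero_tails\<close> eliminates
    it; the subtracted term turns \<open>b - 1\<close> into \<open>b - 2\<close> at
    \<open>k - 2\<close> and yields the negative term at \<open>k - 3\<close>.\<close>
  moreover have "int (card (zero_tails b (Suc n) (k - 1))) =
      int (card (strings b (n + 2) (k - 1))) - int (card (nonzero_tails b (Suc n) (k - 1)))"
    by (simp add: card_strings_Suc)
  ultimately show ?thesis
    by (simp add: nonzero algebra_simps)
qed

lemma card_strings_1: "card (strings b 1 k) = (if k = 0 then 1 else 0)"
  by (simp add: card_strings_Suc card_zero_tails_0 card_nonzero_tails_0)

text \<open>The cube is the path from \<open>00\<close> to \<open>0b\<close>: its two ends have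
  degree 1, the \<open>b - 1\<close> strings between them degree 2.\<close>

lemma card_strings_2:
  assumes "b \<ge> 1"
  shows "card (strings b 2 k) = (if k = 1 then 2 else if k = 2 then b - 1 else 0)"
proof -
  have "card (strings b (Suc (Suc 0)) k) = (if k = 1 then 2 else if k = 2 then b - 1 else 0)"
    using assms by (simp add: card_strings_Suc[of b "Suc 0"] card_zero_tails_Suc
        card_nonzero_tails_Suc card_strings_0 card_zero_tails_0 card_nonzero_tails_0)
  then show ?thesis
    by (simp add: numeral_2_eq_2)
qed

theorem theorem12:
  fixes b :: nat
  assumes "b \<ge> 1"
  shows "(\<forall>n\<ge>3. \<forall>k\<ge>0.
            int (\<Delta> b n k) =
              int (\<Delta> b (n - 1) (k - 1)) + int (\<Delta> b (n - 2) (k - 1))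
              + (int b - 1) * int (\<Delta> b (n - 2) (k - 2))
              + int (\<Delta> b (n - 3) (k - 1))
              + (int b - 2) * int (\<Delta> b (n - 3) (k - 2))
              - (int b - 1) * int (\<Delta> b (n - 3) (k - 3))) \<and>
         \<Delta> b 0 0 = 1 \<and> (\<forall>k. k \<noteq> 0 \<longrightarrow> \<Delta> b 0 k = 0) \<and>
         \<Delta> b 1 0 = 1 \<and> (\<forall>k. k \<noteq> 0 \<longrightarrow> \<Delta> b 1 k = 0) \<and>
         \<Delta> b 2 1 = 2 \<and> int (\<Delta> b 2 2) = int b - 1 \<and>
         (\<forall>k. k \<notin> {1, 2} \<longrightarrow> \<Delta> b 2 k = 0)"
proof -
  have "\<Delta> b n k =
      int (\<Delta> b (n - 1) (k - 1)) + int (\<Delta> b (n - 2) (k - 1))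
      + (int b - 1) * int (\<Delta> b (n - 2) (k - 2))
      + int (\<Delta> b (n - 3) (k - 1))
      + (int b - 2) * int (\<Delta> b (n - 3) (k - 2))
      - (int b - 1) * int (\<Delta> b (n - 3) (k - 3))" if "n \<ge> 3" for n k
  proof -
    have "n = (n - 3) + 3"
      using that by simp
    then obtain m where "n = m + 3"
      by blast
    then show ?thesis
      using card_strings_recurrence[OF assms, of m k] by (simp add: Delta_eq_card_strings[OF assms])
  qed
  then show ?thesis
    using assms by (simp add: Delta_eq_card_strings card_strings_0 card_strings_1[simplified]
        card_strings_2 of_nat_diff)
qed

end
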